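(* For each $j=0,\ldots,5$ and each $q$ with $0<|q|\neq1$, the sequence $y_\lambda(q)=H_{\lambda,j}(q)$, $\lambda\in\mathbb{Z}$ (defined in the context), satisfies, for all $\lambda\in\mathbb{Z}$, the linear $q$-difference equation $$ y_{\lambda+6}(q)+2\,y_{\lambda+5}(q)-(q+q^{\lambda+4})\,y_{\lambda+4}(q)-2(q+1)\,y_{\lambda+3}(q)-y_{\lambda+2}(q)+2q\,y_{\lambda+1}(q)+q\,y_\lambda(q)=0 . $$
   Context: $(a;q)_m=\prod_{i=0}^{m-1}(1-aq^i)$. Write $q=e^{2\pi i\tau}$; fractional powers mean $q^{r}=e^{2\pi i r\tau}$ (and $(q^{-1})^r=q^{-r}$). For $|q|<1$ put $$E_l^{(m)}(q)=\sum_{s\ge1}\frac{s^{l-1}q^{s(m+1)}}{1-q^s},\qquad \mathcal{E}_2(q)=1-24\sum_{n\ge1}\frac{q^n}{(1-q^n)^2}.$$ For $|q|<1$, $\lambda\in\mathbb{Z}$ and $j=0,1,2$, $$H^+_{\lambda,j}(q)=(-1)^\lambda\sum_{m\ge0}\frac{q^{m(2m+1)+\lambda m}}{(q;q)_m^2(q;q)_{2m}}\,p_{\lambda,j,m}(q),\qquad H^-_{\lambda,j}(q)=(-1)^\lambda\sum_{n\ge0}\frac{q^{n(n+1)+\lambda n}}{(q;q)_n^2(q;q)_{2n}}\,P_{\lambda,j,n}(q),$$ where $p_{\lambda,0,m}=P_{\lambda,0,n}=1$, $$p_{\lambda,1,m}=4m+\lambda+1-2E_1^{(m)}-2E_1^{(2m)},\qquad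 p_{\lambda,2,m}=p_{\lambda,1,m}^2-2E_2^{(m)}-4E_2^{(2m)}-\tfrac13\mathcal{E}_2,$$ $$P_{\lambda,1,n}=2n+\lambda+1-2E_1^{(n)}-2E_1^{(2n)},\qquad P_{\lambda,2,n}=P_{\lambda,1,n}^2+12E_2^{(0)}-\tfrac12-2E_2^{(n)}-4E_2^{(2n)}+\tfrac13\mathcal{E}_2 .$$ For $j=3,4,5$, $$H^+_{\lambda,3}=\frac{(-1)^\lambda q^{1/8}}{(1-q^{1/2})^2}\sum_{m\ge0}\frac{q^{(2m+1)(m+1)+\lambda(m+1/2)}}{(q^{3/2};q)_m^2(q;q)_{2m+1}},\qquad H^-_{\lambda,3}=\frac{(-1)^\lambda q^{-1/8}}{(1-q^{-1/2})^2}\sum_{n\ge0}\frac{q^{n(n+2)+\lambda(n+1/2)}}{(q^{3/2};q)_n^2(q;q)_{2n+1}},$$ $$H^+_{\lambda,4}=\sum_{m\ge0}\frac{q^{(2m+1)m+\lambda m}}{(-q;q)_m^2(q;q)_{2m}},\qquad H^-_{\lambda,4}=\sum_{n\ge0}\frac{q^{n(n+1)+\lambda n}}{(-q;q)_n^2(q;q)_{2n}},$$ $$H^+_{\lambda,5}=\frac{q^{1/8}}{(1+q^{1/2})^2}\sum_{m\ge0}\frac{q^{(2m+1)(m+1)+\lambda(m+1/2)}}{(-q^{3/2};q)_m^2(q;q)_{2m+1}},\qquad H^-_{\lambda,5}=\frac{q^{-1/8}}{(1+q^{-1/2})^2}\sum_{n\ge0}\frac{q^{n(n+2)+\lambda(n+1/2)}}{(-q^{3/2};q)_n^2(q;q)_{2n+1}}.$$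 With $\delta=(\delta_0,\dots,\delta_5)=(0,1,2,0,0,0)$ set $H_{\lambda,j}(q)=H^+_{\lambda,j}(q)$ if $|q|<1$ and $H_{\lambda,j}(q)=(-1)^{\delta_j}H^-_{-\lambda,j}(q^{-1})$ if $|q|>1$. *)

theory Defs
  imports "HOL-Analysis.Analysis"
begin

text \<open>
  Fractional powers of \<open>q = exp (2 \<pi> i \<tau>)\<close> depend on the choice of \<open>\<tau>\<close>, hence functions of \<open>q\<close> are
  rendered as functions of \<open>\<tau>\<close>. Replacing \<open>\<tau>\<close> by \<open>- \<tau>\<close> amounts to replacing \<open>q\<close> by \<open>1 / q\<close>, with
  the convention that the \<open>r\<close>-th power of \<open>1 / q\<close> is the \<open>-r\<close>-th power of \<open>q\<close>.
\<close>

definition qpow :: "complex \<Rightarrow> real \<Rightarrow> complex" where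
  "qpow \<tau> r = exp (2 * complex_of_real pi * \<i> * complex_of_real r * \<tau>)"

abbreviation nome :: "complex \<Rightarrow> complex" where
  "nome \<tau> \<equiv> qpow \<tau> 1"

lemma qpow_of_int: "qpow \<tau> (of_int k) = nome \<tau> powi k"
  unfolding qpow_def exp_power_int by (simp add: mult_ac)

lemma qpow_uminus: "qpow (- \<tau>) r = qpow \<tau> (- r)"
  unfolding qpow_def by simp

lemma nome_uminus: "nome (- \<tau>) = inverse (nome \<tau>)"
  unfolding qpow_def by (simp add: exp_minus)

definition qpoch :: "complex \<Rightarrow> complex \<Rightarrow> nat \<Rightarrow> complex" where
  "qpoch a q m = (\<Prod>i<m. 1 - a * q ^ i)"

text \<open>The series over \<open>s \<ge> 1\<close> and \<open>n \<ge> 1\<close> are indexed from \<open>0\<close> via \<open>Suc\<close>; only \<open>l \<ge> 1\<close> is used.\<close>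

definition Eser :: "nat \<Rightarrow> nat \<Rightarrow> complex \<Rightarrow> complex" where
  "Eser l m q = (\<Sum>s. of_nat (Suc s) ^ (l - 1) * q ^ (Suc s * (m + 1)) / (1 - q ^ Suc s))"

definition Eis2 :: "complex \<Rightarrow> complex" where
  "Eis2 q = 1 - 24 * (\<Sum>n. q ^ Suc n / (1 - q ^ Suc n)\<^sup>2)"

definition p1 :: "int \<Rightarrow> nat \<Rightarrow> complex \<Rightarrow> complex" where
  "p1 l m q = 4 * of_nat m + of_int l + 1 - 2 * Eser 1 m q - 2 * Eser 1 (2 * m) q"

definition p2 :: "int \<Rightarrow> nat \<Rightarrow> complex \<Rightarrow> complex" where
  "p2 l m q = (p1 l m q)\<^sup>2 - 2 * Eser 2 m q - 4 * Eser 2 (2 * m) q - 1 / 3 * Eis2 q"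

definition P1 :: "int \<Rightarrow> nat \<Rightarrow> complex \<Rightarrow> complex" where
  "P1 l n q = 2 * of_nat n + of_int l + 1 - 2 * Eser 1 n q - 2 * Eser 1 (2 * n) q"

definition P2 :: "int \<Rightarrow> nat \<Rightarrow> complex \<Rightarrow> complex" where
  "P2 l n q = (P1 l n q)\<^sup>2 + 12 * Eser 2 0 q - 1 / 2 - 2 * Eser 2 n q - 4 * Eser 2 (2 * n) q
     + 1 / 3 * Eis2 q"

definition p_coeff :: "nat \<Rightarrow> int \<Rightarrow> nat \<Rightarrow> complex \<Rightarrow> complex" where
  "p_coeff j l m q = (if j = 0 then 1 else if j = 1 then p1 l m q else p2 l m q)"

definition P_coeff :: "nat \<Rightarrow> int \<Rightarrow> nat \<Rightarrow> complex \<Rightarrow> complex" where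
  "P_coeff j l n q = (if j = 0 then 1 else if j = 1 then P1 l n q else P2 l n q)"

text \<open>
  The series \<open>Hplus\<close> and \<open>Hminus\<close> are meant for \<open>norm (nome \<tau>) < 1\<close>, i.e. \<open>Im \<tau> > 0\<close>, and \<open>j \<le> 5\<close>.
\<close>

definition Hplus :: "nat \<Rightarrow> int \<Rightarrow> complex \<Rightarrow> complex" where
  "Hplus j l \<tau> = (let q = nome \<tau> in
     if j \<le> 2 then
       (-1) powi l * (\<Sum>m. q powi (int m * (2 * int m + 1) + l * int m)
          / ((qpoch q q m)\<^sup>2 * qpoch q q (2 * m)) * p_coeff j l m q)
     else if j = 3 then
       (-1) powi l * qpow \<tau> (1/8) / (1 - qpow \<tau> (1/2))\<^sup>2 *
       (\<Sum>m. qpow \<tau> ((2 * real m + 1) * (real m + 1) + of_int l * (real m + 1/2))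
          / ((qpoch (qpow \<tau> (3/2)) q m)\<^sup>2 * qpoch q q (2 * m + 1)))
     else if j = 4 then
       (\<Sum>m. q powi ((2 * int m + 1) * int m + l * int m)
          / ((qpoch (- q) q m)\<^sup>2 * qpoch q q (2 * m)))
     else if j = 5 then
       qpow \<tau> (1/8) / (1 + qpow \<tau> (1/2))\<^sup>2 *
       (\<Sum>m. qpow \<tau> ((2 * real m + 1) * (real m + 1) + of_int l * (real m + 1/2))
          / ((qpoch (- qpow \<tau> (3/2)) q m)\<^sup>2 * qpoch q q (2 * m + 1)))
     else 0)"

definition Hminus :: "nat \<Rightarrow> int \<Rightarrow> complex \<Rightarrow> complex" where
  "Hminus j l \<tau> = (let q = nome \<tau> in
     if j \<le> 2 then
       (-1) powi l * (\<Sum>n. q powi (int n * (int n + 1) + l * int n)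
          / ((qpoch q q n)\<^sup>2 * qpoch q q (2 * n)) * P_coeff j l n q)
     else if j = 3 then
       (-1) powi l * qpow \<tau> (-1/8) / (1 - qpow \<tau> (-1/2))\<^sup>2 *
       (\<Sum>n. qpow \<tau> (real n * (real n + 2) + of_int l * (real n + 1/2))
          / ((qpoch (qpow \<tau> (3/2)) q n)\<^sup>2 * qpoch q q (2 * n + 1)))
     else if j = 4 then
       (\<Sum>n. q powi (int n * (int n + 1) + l * int n)
          / ((qpoch (- q) q n)\<^sup>2 * qpoch q q (2 * n)))
     else if j = 5 then
       qpow \<tau> (-1/8) / (1 + qpow \<tau> (-1/2))\<^sup>2 *
       (\<Sum>n. qpow \<tau> (real n * (real n + 2) + of_int l * (real n + 1/2))
          / ((qpoch (- qpow \<tau> (3/2)) q n)\<^sup>2 * qpoch q q (2 * n + 1)))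
     else 0)"

definition delta :: "nat \<Rightarrow> nat" where
  "delta j = [0, 1, 2, 0, 0, 0] ! j"

text \<open>The case \<open>norm (nome \<tau>) = 1\<close> is a junk value.\<close>

definition H :: "nat \<Rightarrow> int \<Rightarrow> complex \<Rightarrow> complex" where
  "H j l \<tau> = (if norm (nome \<tau>) < 1 then Hplus j l \<tau>
     else if norm (nome \<tau>) > 1 then (-1) ^ delta j * Hminus j (- l) (- \<tau>)
     else 0)"

end

theory Submission
  imports Defs
begin

text \<open>
  Apart from the single term \<open>q\<^sup>\<lambda>\<^sup>+\<^sup>4 y\<^sub>\<lambda>\<^sub>+\<^sub>4\<close>, the equation has coefficients that do not depend on \<open>\<lambda>\<close>,
  and the characteristic polynomial of that constant-coefficient part factors as
  \<open>Q(X) = (1 + X)\<^sup>2 (1 - X\<^sup>2) (q - X\<^sup>2)\<close>. All six functions are series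
  \<open>y\<^sub>\<lambda> = \<Sum>\<^sub>m c\<^sub>m X\<^sub>m\<^sup>\<lambda>\<close>, up to polynomial weights in \<open>\<lambda>\<close>, over a geometric progression
  \<open>X\<^sub>m = X\<^sub>0 q\<^sup>m\<close> that starts at a root of \<open>Q\<close>. The constant-coefficient part multiplies the
  \<open>m\<close>-th term by \<open>Q(X\<^sub>m)\<close>: this kills the term \<open>m = 0\<close>, and the recurrence
  \<open>c\<^sub>m\<^sub>+\<^sub>1 Q(X\<^sub>m\<^sub>+\<^sub>1) = c\<^sub>m X\<^sub>m\<^sub>+\<^sub>1\<^sup>4\<close> turns the term \<open>m + 1\<close> into \<open>q\<^sup>\<lambda>\<^sup>+\<^sup>4\<close> times the \<open>m\<close>-th term
  of \<open>y\<^sub>\<lambda>\<^sub>+\<^sub>4\<close>. Summing over \<open>m\<close> gives the equation (\<open>series_solution_telescope\<close>).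

  The root \<open>X\<^sub>0\<close> is \<open>-1\<close> for \<open>j = 0, 1, 2\<close>, and \<open>-q\<^sup>1\<^sup>/\<^sup>2\<close>, \<open>1\<close>, \<open>q\<^sup>1\<^sup>/\<^sup>2\<close> for \<open>j = 3, 4, 5\<close>. The first
  one is a triple root, which leaves room for the method of Frobenius: the solutions for
  \<open>j = 1, 2\<close> are the first and second derivatives of the solution for \<open>j = 0\<close> with respect to a
  shift of the summation index, up to adding a multiple of that solution. Concretely the \<open>m\<close>-th term carries the weight \<open>\<lambda> + a\<^sub>m\<close> or
  \<open>(\<lambda> + a\<^sub>m)\<^sup>2 + b\<^sub>m\<close>, where the increments of \<open>a\<^sub>m\<close> and \<open>b\<^sub>m\<close> are given by the logarithmic
  derivative of \<open>Q\<close> (\<open>series_solution_frobenius\<close>); the Lambert series \<open>E\<^sub>1\<close> and \<open>E\<^sub>2\<close> have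
  exactly these increments.

  Nothing in this argument distinguishes \<open>|q| < 1\<close> from \<open>|q| > 1\<close>. The ratio of consecutive terms
  tends to \<open>0\<close> in both cases, because \<open>X\<^sup>4 / Q(X)\<close> vanishes both at \<open>0\<close> and at infinity, and
  rewriting the series for \<open>|q| > 1\<close> in powers of \<open>1 / q\<close> gives \<open>H\<^sup>-\<close>.
\<close>

section \<open>The characteristic polynomial and its logarithmic derivative\<close>

definition charpoly :: "complex \<Rightarrow> complex \<Rightarrow> complex" where
  "charpoly q X = (1 + X)\<^sup>2 * (1 - X\<^sup>2) * (q - X\<^sup>2)"

definition const_op :: "complex \<Rightarrow> (int \<Rightarrow> complex) \<Rightarrow> int \<Rightarrow> complex" where
  "const_op q y l = y (l + 6) + 2 * y (l + 5) - q * y (l + 4) - 2 * (q + 1) * y (l + 3)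
     - y (l + 2) + 2 * q * y (l + 1) + q * y l"

lemma const_op_cmult: "const_op q (\<lambda>l. a * y l) l = a * const_op q y l"
  unfolding const_op_def by algebra

lemma const_op_power:
  assumes "X \<noteq> 0"
  shows "const_op q (\<lambda>l. X powi l) l = X powi l * charpoly q X"
  unfolding const_op_def charpoly_def using assms by (simp add: power_int_add) algebra

text \<open>
  With \<open>\<theta> = X d/dX\<close>, these are \<open>\<theta> Q / Q\<close> and \<open>\<theta> (\<theta> Q / Q)\<close> for the characteristic polynomial \<open>Q\<close>,
  written as sums over its factors.
\<close>

definition theta_log :: "complex \<Rightarrow> complex \<Rightarrow> complex" where
  "theta_log q X = 2 * X / (1 + X) - 2 * X\<^sup>2 / (1 - X\<^sup>2) - 2 * X\<^sup>2 / (q - X\<^sup>2)"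

definition theta2_log :: "complex \<Rightarrow> complex \<Rightarrow> complex" where
  "theta2_log q X = 2 * X / (1 + X)\<^sup>2 - 4 * X\<^sup>2 / (1 - X\<^sup>2)\<^sup>2 - 4 * q * X\<^sup>2 / (q - X\<^sup>2)\<^sup>2"

lemma charpoly_nonzero_iff:
  "charpoly q X \<noteq> 0 \<longleftrightarrow> 1 + X \<noteq> 0 \<and> 1 - X\<^sup>2 \<noteq> 0 \<and> q - X\<^sup>2 \<noteq> 0"
  unfolding charpoly_def by auto

text \<open>
  The right-hand sides of this and the next lemma are \<open>\<theta> Q\<close> and \<open>\<theta>\<^sup>2 Q\<close> in expanded form: they are
  what the operator produces from the weights \<open>\<lambda>\<close> and \<open>\<lambda>\<^sup>2\<close>.
\<close>

lemma theta_charpoly: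
  assumes "charpoly q X \<noteq> 0"
  shows "charpoly q X * theta_log q X
    = 6 * X^6 + 10 * X^5 - 4 * q * X^4 - 6 * (q + 1) * X^3 - 2 * X^2 + 2 * q * X"
proof -
  have nz: "1 + X \<noteq> 0" "1 - X\<^sup>2 \<noteq> 0" "q - X\<^sup>2 \<noteq> 0"
    using assms by (auto simp: charpoly_nonzero_iff)
  define u v w where "u = 2 * X / (1 + X)" "v = 2 * X\<^sup>2 / (1 - X\<^sup>2)" "w = 2 * X\<^sup>2 / (q - X\<^sup>2)"
  have "u * (1 + X) = 2 * X" "v * (1 - X\<^sup>2) = 2 * X\<^sup>2" "w * (q - X\<^sup>2) = 2 * X\<^sup>2"
    using nz by (auto simp: u_v_w_def)
  thus ?thesis
    unfolding charpoly_def theta_log_def u_v_w_def[symmetric] by algebra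
qed

lemma theta2_charpoly:
  assumes "charpoly q X \<noteq> 0"
  shows "charpoly q X * ((theta_log q X)\<^sup>2 + theta2_log q X)
    = 36 * X^6 + 50 * X^5 - 16 * q * X^4 - 18 * (q + 1) * X^3 - 4 * X^2 + 2 * q * X"
proof -
  have nz: "1 + X \<noteq> 0" "1 - X\<^sup>2 \<noteq> 0" "q - X\<^sup>2 \<noteq> 0"
    using assms by (auto simp: charpoly_nonzero_iff)
  define a b c where "a = 1 / (1 + X)" "b = 1 / (1 - X\<^sup>2)" "c = 1 / (q - X\<^sup>2)"
  have abc: "a * (1 + X) = 1" "b * (1 - X\<^sup>2) = 1" "c * (q - X\<^sup>2) = 1"
    using nz by (auto simp: a_b_c_def)
  have r: "theta_log q X = 2 * X * a - 2 * X\<^sup>2 * b - 2 * X\<^sup>2 * c"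
    "theta2_log q X = 2 * X * a\<^sup>2 - 4 * X\<^sup>2 * b\<^sup>2 - 4 * q * X\<^sup>2 * c\<^sup>2"
    unfolding theta_log_def theta2_log_def a_b_c_def by (simp_all add: power_divide)
  show ?thesis
    unfolding charpoly_def r using abc by algebra
qed

text \<open>
  Since \<open>\<theta> X\<^sup>\<lambda> = \<lambda> X\<^sup>\<lambda>\<close>, a weight that is polynomial in \<open>\<lambda>\<close> acts as a differential operator on
  \<open>X\<^sup>\<lambda> Q(X)\<close>. Dividing by \<open>Q\<close> shows that the operator shifts \<open>\<lambda> + a\<close> by \<open>\<theta> Q / Q\<close>, and \<open>b\<close> by
  the derivative of that shift.
\<close>

lemma const_op_linear_weight:
  assumes "X \<noteq> 0" and nz: "charpoly q X \<noteq> 0"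
  shows "const_op q (\<lambda>l. (of_int l + a) * X powi l) l
    = X powi l * charpoly q X * (of_int l + a + theta_log q X)"
proof -
  have "const_op q (\<lambda>l. (of_int l + a) * X powi l) l
     = X powi l * (charpoly q X * (of_int l + a)
        + (6 * X^6 + 10 * X^5 - 4 * q * X^4 - 6 * (q + 1) * X^3 - 2 * X^2 + 2 * q * X))"
    unfolding const_op_def charpoly_def using assms by (simp add: power_int_add) algebra
  also have "\<dots> = X powi l * charpoly q X * (of_int l + a + theta_log q X)"
    unfolding theta_charpoly[OF nz, symmetric] by algebra
  finally show ?thesis .
qed

lemma const_op_quadratic_weight:
  assumes "X \<noteq> 0" and nz: "charpoly q X \<noteq> 0"
  shows "const_op q (\<lambda>l. ((of_int l + a)\<^sup>2 + b) * X powi l) l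
    = X powi l * charpoly q X * ((of_int l + a + theta_log q X)\<^sup>2 + b + theta2_log q X)"
proof -
  have "const_op q (\<lambda>l. ((of_int l + a)\<^sup>2 + b) * X powi l) l
     = X powi l * (charpoly q X * ((of_int l + a)\<^sup>2 + b)
        + 2 * (of_int l + a) * (6 * X^6 + 10 * X^5 - 4 * q * X^4 - 6 * (q + 1) * X^3 - 2 * X^2 + 2 * q * X)
        + (36 * X^6 + 50 * X^5 - 16 * q * X^4 - 18 * (q + 1) * X^3 - 4 * X^2 + 2 * q * X))"
    unfolding const_op_def charpoly_def using assms by (simp add: power_int_add) algebra
  also have "\<dots> = X powi l * charpoly q X * ((of_int l + a + theta_log q X)\<^sup>2 + b + theta2_log q X)"
    unfolding theta_charpoly[OF nz, symmetric] theta2_charpoly[OF nz, symmetric] by algebra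
  finally show ?thesis .
qed

text \<open>
  At the triple root \<open>X = -1\<close> all of \<open>Q\<close>, \<open>\<theta> Q\<close> and \<open>\<theta>\<^sup>2 Q\<close> vanish, so the initial term of the series
  is annihilated even with a quadratic weight.
\<close>

lemma const_op_triple_root:
  "const_op q (\<lambda>l. (of_int l + a) * (-1) powi l) l = 0"
  "const_op q (\<lambda>l. ((of_int l + a)\<^sup>2 + b) * (-1) powi l) l = 0"
  unfolding const_op_def by (simp add: power_int_add, algebra)+

section \<open>Growth estimates\<close>

text \<open>
  The progression tends to \<open>0\<close> or to infinity, and all three rational functions have finite limits
  at both points. The first limit makes the term ratios tend to \<open>0\<close>; the other two bound the
  increments of the weights.
\<close>

lemma geometric_limits:
  fixes q X0 :: complex
  assumes "q \<noteq> 0" "X0 \<noteq> 0" "norm q \<noteq> 1"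
  defines "X \<equiv> \<lambda>m. X0 * q ^ m"
  shows "(\<lambda>m. X m ^ 4 / charpoly q (X m)) \<longlonglongrightarrow> 0"
    and "convergent (\<lambda>m. theta_log q (X m))"
    and "convergent (\<lambda>m. theta2_log q (X m))"
proof -
  have "(\<lambda>m. X m ^ 4 / charpoly q (X m)) \<longlonglongrightarrow> 0 \<and> convergent (\<lambda>m. theta_log q (X m))
    \<and> convergent (\<lambda>m. theta2_log q (X m))"
  proof (cases "norm q < 1")
    case True
    have X: "X \<longlonglongrightarrow> 0"
      unfolding X_def using tendsto_mult[OF tendsto_const LIMSEQ_power_zero[OF True], of X0] by simp
    have 1: "(\<lambda>m. X m ^ 4 / charpoly q (X m)) \<longlonglongrightarrow> 0"
      unfolding charpoly_def using \<open>q \<noteq> 0\<close> by (auto intro!: tendsto_eq_intros X)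
    have 2: "(\<lambda>m. theta_log q (X m)) \<longlonglongrightarrow> 0"
      unfolding theta_log_def using \<open>q \<noteq> 0\<close> by (auto intro!: tendsto_eq_intros X)
    have 3: "(\<lambda>m. theta2_log q (X m)) \<longlonglongrightarrow> 0"
      unfolding theta2_log_def using \<open>q \<noteq> 0\<close> by (auto intro!: tendsto_eq_intros X)
    show ?thesis using 1 2 3 by (auto intro: convergentI)
  next
    case False
    with assms have "norm (inverse q) < 1" by (simp add: norm_inverse inverse_less_1_iff)
    \<comment> \<open>Near infinity everything is a rational function of \<open>Y = 1 / X\<close> that is regular at \<open>Y = 0\<close>.\<close>
    define Y where "Y = (\<lambda>m. inverse X0 * inverse q ^ m)"
    have Y: "Y \<longlonglongrightarrow> 0"
      unfolding Y_def
      using tendsto_mult[OF tendsto_const LIMSEQ_power_zero[OF \<open>norm (inverse q) < 1\<close>], of "inverse X0"]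
      by simp
    have XY: "X m = 1 / Y m" "Y m \<noteq> 0" for m
      using assms by (auto simp: X_def Y_def field_simps)
    have e1: "1 + X m = (Y m + 1) / Y m" "1 - (X m)\<^sup>2 = ((Y m)\<^sup>2 - 1) / (Y m)\<^sup>2"
      "q - (X m)\<^sup>2 = (q * (Y m)\<^sup>2 - 1) / (Y m)\<^sup>2" for m
      using XY(2)[of m] by (simp_all add: XY(1) field_simps)
    have "X m ^ 4 / charpoly q (X m)
        = (Y m)\<^sup>2 / ((Y m + 1)\<^sup>2 * ((Y m)\<^sup>2 - 1) * (q * (Y m)\<^sup>2 - 1))" for m
      unfolding charpoly_def e1 using XY(2)[of m]
      by (simp add: XY(1) power_divide eval_nat_numeral)
    moreover have "(\<lambda>m. (Y m)\<^sup>2 / ((Y m + 1)\<^sup>2 * ((Y m)\<^sup>2 - 1) * (q * (Y m)\<^sup>2 - 1))) \<longlonglongrightarrow> 0"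
      by (auto intro!: tendsto_eq_intros Y)
    ultimately have 1: "(\<lambda>m. X m ^ 4 / charpoly q (X m)) \<longlonglongrightarrow> 0" by simp
    have "theta_log q (X m) = 2 / (Y m + 1) - 2 / ((Y m)\<^sup>2 - 1) - 2 / (q * (Y m)\<^sup>2 - 1)" for m
      unfolding theta_log_def e1 using XY(2)[of m] by (simp add: XY(1) power_divide)
    moreover have "(\<lambda>m. 2 / (Y m + 1) - 2 / ((Y m)\<^sup>2 - 1) - 2 / (q * (Y m)\<^sup>2 - 1)) \<longlonglongrightarrow> 6"
      by (auto intro!: tendsto_eq_intros Y)
    ultimately have 2: "(\<lambda>m. theta_log q (X m)) \<longlonglongrightarrow> 6" by simp
    have "theta2_log q (X m) = 2 * Y m / (Y m + 1)\<^sup>2 - 4 * (Y m)\<^sup>2 / ((Y m)\<^sup>2 - 1)\<^sup>2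
        - 4 * q * (Y m)\<^sup>2 / (q * (Y m)\<^sup>2 - 1)\<^sup>2" for m
      unfolding theta2_log_def e1 using XY(2)[of m]
      by (simp add: XY(1) power_divide eval_nat_numeral)
    moreover have "(\<lambda>m. 2 * Y m / (Y m + 1)\<^sup>2 - 4 * (Y m)\<^sup>2 / ((Y m)\<^sup>2 - 1)\<^sup>2
        - 4 * q * (Y m)\<^sup>2 / (q * (Y m)\<^sup>2 - 1)\<^sup>2) \<longlonglongrightarrow> 0"
      by (auto intro!: tendsto_eq_intros Y)
    ultimately have 3: "(\<lambda>m. theta2_log q (X m)) \<longlonglongrightarrow> 0" by simp
    show ?thesis using 1 2 3 by (auto intro: convergentI)
  qed
  thus "(\<lambda>m. X m ^ 4 / charpoly q (X m)) \<longlonglongrightarrow> 0"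
    and "convergent (\<lambda>m. theta_log q (X m))"
    and "convergent (\<lambda>m. theta2_log q (X m))" by auto
qed

lemma linear_growth:
  fixes a :: "nat \<Rightarrow> complex"
  assumes "convergent (\<lambda>m. a (Suc m) - a m)"
  obtains K where "K \<ge> 0" "\<And>m. norm (a m) \<le> K * real (Suc m)"
proof -
  obtain B where B: "\<And>m. norm (a (Suc m) - a m) \<le> B"
    using convergent_imp_Bseq[OF assms] unfolding Bseq_def by auto
  define K where "K = max B (norm (a 0))"
  have "norm (a m) \<le> K * real (Suc m)" for m
  proof (induction m)
    case (Suc m)
    have "norm (a (Suc m)) \<le> norm (a (Suc m) - a m) + norm (a m)"
      by (metis diff_add_cancel norm_triangle_ineq)
    also have "\<dots> \<le> K + K * real (Suc m)"
      using B[of m] Suc by (auto simp: K_def)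
    finally show ?case by (simp add: algebra_simps)
  qed (simp add: K_def)
  moreover have "K \<ge> 0" by (simp add: K_def le_max_iff_disj)
  ultimately show ?thesis using that by blast
qed

lemma summable_ratio_zero_weighted:
  fixes f w \<rho> :: "nat \<Rightarrow> complex"
  assumes ratio: "\<And>m. f (Suc m) = f m * \<rho> m" and "\<rho> \<longlonglongrightarrow> 0"
    and growth: "\<And>m. norm (w m) \<le> K * (real (Suc m))\<^sup>2"
  shows "summable (\<lambda>m. w m * f m)"
proof -
  \<comment> \<open>The bound \<open>(m + 1)\<^sup>2\<close> grows at most by the factor 4 in each step, so a ratio below 1/8 leaves 1/2.\<close>
  have "(\<lambda>m. norm (\<rho> m)) \<longlonglongrightarrow> 0"
    using \<open>\<rho> \<longlonglongrightarrow> 0\<close> tendsto_norm_zero by blast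
  hence "\<forall>\<^sub>F m in sequentially. norm (\<rho> m) < 1/8"
    by (rule order_tendstoD) simp
  then obtain N where N: "\<And>m. m \<ge> N \<Longrightarrow> norm (\<rho> m) < 1/8"
    unfolding eventually_sequentially by auto
  have "summable (\<lambda>m. (real (Suc m))\<^sup>2 * norm (f m))"
  proof (rule summable_ratio_test)
    fix m assume "m \<ge> N"
    have "(real (Suc (Suc m)))\<^sup>2 \<le> (2 * real (Suc m))\<^sup>2"
      by (rule power_mono) auto
    hence "(real (Suc (Suc m)))\<^sup>2 * norm (f (Suc m))
        \<le> (2 * real (Suc m))\<^sup>2 * (norm (f m) * (1/8))"
      unfolding ratio norm_mult using N[OF \<open>m \<ge> N\<close>]
      by (intro mult_mono mult_left_mono) auto
    also have "\<dots> = 1/2 * ((real (Suc m))\<^sup>2 * norm (f m))"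
      by (simp add: power_mult_distrib del: of_nat_Suc)
    finally show "norm ((real (Suc (Suc m)))\<^sup>2 * norm (f (Suc m)))
        \<le> 1/2 * norm ((real (Suc m))\<^sup>2 * norm (f m))" by simp
  qed simp
  hence "summable (\<lambda>m. K * ((real (Suc m))\<^sup>2 * norm (f m)))"
    by (rule summable_mult)
  thus ?thesis
  proof (rule summable_comparison_test'[where N = 0])
    fix m
    show "norm (w m * f m) \<le> K * ((real (Suc m))\<^sup>2 * norm (f m))"
      using mult_right_mono[OF growth[of m], of "norm (f m)"] by (simp add: norm_mult mult_ac)
  qed
qed

section \<open>Series solutions\<close>

definition solves_at :: "complex \<Rightarrow> (int \<Rightarrow> complex) \<Rightarrow> int \<Rightarrow> bool" where
  "solves_at q y l \<longleftrightarrow> const_op q y l = q powi (l + 4) * y (l + 4)"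

text \<open>
  Summability is part of the notion so that constant factors can be moved across the sum.
\<close>

definition series_solution :: "complex \<Rightarrow> (int \<Rightarrow> nat \<Rightarrow> complex) \<Rightarrow> bool" where
  "series_solution q F \<longleftrightarrow>
     (\<forall>l. summable (F l)) \<and> (\<forall>l. solves_at q (\<lambda>l. suminf (F l)) l)"

text \<open>
  The constant-coefficient part removes the term of index \<open>0\<close> and moves every other term one
  place down, which is the effect of the remaining term of the equation.
\<close>

lemma series_solution_telescope:
  assumes sm: "\<And>l. summable (F l)"
    and base: "\<And>l. const_op q (\<lambda>l. F l 0) l = 0"
    and step: "\<And>l m. const_op q (\<lambda>l. F l (Suc m)) l = q powi (l + 4) * F (l + 4) m"
  shows "series_solution q F"
  unfolding series_solution_def
proof (intro conjI allI sm)
  fix l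
  have "(\<lambda>m. const_op q (\<lambda>l. F l m) l) sums const_op q (\<lambda>l. suminf (F l)) l"
    unfolding const_op_def by (intro sums_add sums_diff sums_mult summable_sums sm)
  hence "(\<lambda>m. const_op q (\<lambda>l. F l (Suc m)) l) sums const_op q (\<lambda>l. suminf (F l)) l"
    by (subst sums_Suc_iff) (simp add: base)
  moreover have "(\<lambda>m. const_op q (\<lambda>l. F l (Suc m)) l) sums (q powi (l + 4) * suminf (F (l + 4)))"
    unfolding step by (intro sums_mult summable_sums sm)
  ultimately show "solves_at q (\<lambda>l. suminf (F l)) l"
    unfolding solves_at_def by (rule sums_unique2)
qed

text \<open>
  The weights are kept abstract here because only the following matters: at most quadratic
  growth in \<open>m\<close>, for convergence, and that the operator annihilates the term \<open>m = 0\<close> and carries the weight of index \<open>m + 1\<close> at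
  \<open>\<lambda>\<close> to the weight of index \<open>m\<close> at \<open>\<lambda> + 4\<close>.
\<close>

lemma series_solution_weighted:
  fixes q X0 :: complex and c :: "nat \<Rightarrow> complex" and W :: "int \<Rightarrow> nat \<Rightarrow> complex"
  defines "X \<equiv> \<lambda>m. X0 * q ^ m"
  assumes q: "q \<noteq> 0" "norm q \<noteq> 1" and X0: "X0 \<noteq> 0"
    and nz: "\<And>m. charpoly q (X (Suc m)) \<noteq> 0"
    and c: "\<And>m. c (Suc m) * charpoly q (X (Suc m)) = c m * X (Suc m) ^ 4"
    and growth: "\<And>l. \<exists>K. \<forall>m. norm (W l m) \<le> K * (real (Suc m))\<^sup>2"
    and base: "\<And>l. const_op q (\<lambda>l. W l 0 * X 0 powi l) l = 0"
    and step: "\<And>l m. const_op q (\<lambda>l. W l (Suc m) * X (Suc m) powi l) l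
       = X (Suc m) powi l * charpoly q (X (Suc m)) * W (l + 4) m"
  shows "series_solution q (\<lambda>l m. W l m * (c m * X m powi l))"
proof (rule series_solution_telescope)
  fix l
  obtain K where K: "\<And>m. norm (W l m) \<le> K * (real (Suc m))\<^sup>2" using growth by blast
  define \<rho> where "\<rho> = (\<lambda>m. q powi l * (X (Suc m) ^ 4 / charpoly q (X (Suc m))))"
  show "summable (\<lambda>m. W l m * (c m * X m powi l))"
  proof (rule summable_ratio_zero_weighted[where \<rho> = \<rho> and K = K])
    fix m
    have "X (Suc m) = X m * q" by (simp add: X_def)
    hence "X (Suc m) powi l = X m powi l * q powi l" by (simp add: power_int_mult_distrib)
    thus "c (Suc m) * X (Suc m) powi l = c m * X m powi l * \<rho> m"
      unfolding \<rho>_def using c[of m] nz[of m] by (simp add: field_simps)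
  next
    have "(\<lambda>m. X (Suc m) ^ 4 / charpoly q (X (Suc m))) \<longlonglongrightarrow> 0"
      using LIMSEQ_Suc[OF geometric_limits(1)[OF q(1) X0 q(2)]] by (simp add: X_def)
    from tendsto_mult[OF tendsto_const this] show "\<rho> \<longlonglongrightarrow> 0"
      unfolding \<rho>_def by auto
  qed (use K in auto)
next
  fix l
  show "const_op q (\<lambda>l. W l 0 * (c 0 * X 0 powi l)) l = 0"
    using const_op_cmult[of q "c 0" "\<lambda>l. W l 0 * X 0 powi l" l] base[of l] by (simp add: mult_ac)
next
  fix l m
  have X: "X (Suc m) = q * X m" "X (Suc m) \<noteq> 0" using q X0 by (auto simp: X_def)
  have "const_op q (\<lambda>l. W l (Suc m) * (c (Suc m) * X (Suc m) powi l)) l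
     = c (Suc m) * charpoly q (X (Suc m)) * (X (Suc m) powi l * W (l + 4) m)"
    using const_op_cmult[of q "c (Suc m)" "\<lambda>l. W l (Suc m) * X (Suc m) powi l" l] step[of m l]
    by (simp add: mult_ac)
  also have "\<dots> = c m * X (Suc m) powi (l + 4) * W (l + 4) m"
    unfolding c using X(2) by (simp add: power_int_add)
  also have "\<dots> = q powi (l + 4) * (W (l + 4) m * (c m * X m powi (l + 4)))"
    unfolding X(1) by (simp add: power_int_mult_distrib)
  finally show "const_op q (\<lambda>l. W l (Suc m) * (c (Suc m) * X (Suc m) powi l)) l
     = q powi (l + 4) * (W (l + 4) m * (c m * X m powi (l + 4)))" .
qed

lemma series_solution_hypergeometric:
  fixes q X0 :: complex and c :: "nat \<Rightarrow> complex"
  defines "X \<equiv> \<lambda>m. X0 * q ^ m"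
  assumes q: "q \<noteq> 0" "norm q \<noteq> 1" and X0: "X0 \<noteq> 0" "charpoly q X0 = 0"
    and nz: "\<And>m. charpoly q (X (Suc m)) \<noteq> 0"
    and c: "\<And>m. c (Suc m) * charpoly q (X (Suc m)) = c m * X (Suc m) ^ 4"
  shows "series_solution q (\<lambda>l m. c m * X m powi l)"
proof -
  have "series_solution q (\<lambda>l m. (\<lambda>_ _. 1) l m * (c m * X m powi l))"
    unfolding X_def
  proof (rule series_solution_weighted)
    show "\<exists>K. \<forall>m. norm (1::complex) \<le> K * (real (Suc m))\<^sup>2" for l
      by (intro exI[of _ 1] allI) simp
    show "const_op q (\<lambda>l. 1 * (X0 * q ^ 0) powi l) l = 0" for l
      using X0 by (simp add: const_op_power)
    show "const_op q (\<lambda>l. 1 * (X0 * q ^ Suc m) powi l) l =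
      (X0 * q ^ Suc m) powi l * charpoly q (X0 * q ^ Suc m) * 1" for l m
      using X0 q by (simp add: const_op_power)
  qed (use assms in auto)
  thus ?thesis by simp
qed

text \<open>
  The hypotheses on \<open>a\<close> and \<open>b\<close> say that the shift caused by the operator at \<open>X\<^sub>m\<^sub>+\<^sub>1\<close> replaces
  \<open>\<lambda> + a\<^sub>m\<^sub>+\<^sub>1\<close> by \<open>(\<lambda> + 4) + a\<^sub>m\<close> and \<open>b\<^sub>m\<^sub>+\<^sub>1\<close> by \<open>b\<^sub>m\<close>. Since these increments converge, \<open>a\<close> and \<open>b\<close>
  grow at most linearly.
\<close>

lemma series_solution_frobenius:
  fixes q :: complex and c a b :: "nat \<Rightarrow> complex"
  defines "X \<equiv> \<lambda>m. - (q ^ m)"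
  assumes q: "q \<noteq> 0" "norm q \<noteq> 1"
    and nz: "\<And>m. charpoly q (X (Suc m)) \<noteq> 0"
    and c: "\<And>m. c (Suc m) * charpoly q (X (Suc m)) = c m * X (Suc m) ^ 4"
    and a: "\<And>m. a (Suc m) + theta_log q (X (Suc m)) = a m + 4"
    and b: "\<And>m. b (Suc m) + theta2_log q (X (Suc m)) = b m"
  shows "series_solution q (\<lambda>l m. (of_int l + a m) * (c m * X m powi l))"
    and "series_solution q (\<lambda>l m. ((of_int l + a m)\<^sup>2 + b m) * (c m * X m powi l))"
proof -
  have X: "X = (\<lambda>m. (-1) * q ^ m)" by (simp add: X_def)
  note lim = geometric_limits[OF q(1) _ q(2), of "-1"]
  have "convergent (\<lambda>m. 4 - theta_log q (X (Suc m)))"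
    using lim(2) convergent_Suc_iff[of "\<lambda>m. theta_log q (X m)"] unfolding X
    by (intro convergent_diff convergent_const) simp
  moreover have "(\<lambda>m. a (Suc m) - a m) = (\<lambda>m. 4 - theta_log q (X (Suc m)))"
    using a by (auto simp: algebra_simps)
  ultimately obtain A where A: "A \<ge> 0" "\<And>m. norm (a m) \<le> A * real (Suc m)"
    using linear_growth[of a] by auto
  have "convergent (\<lambda>m. - theta2_log q (X (Suc m)))"
    using lim(3) convergent_Suc_iff[of "\<lambda>m. theta2_log q (X m)"]
    unfolding X convergent_minus_iff[symmetric] by simp
  moreover have "(\<lambda>m. b (Suc m) - b m) = (\<lambda>m. - theta2_log q (X (Suc m)))"
    by (rule ext) (metis b add_diff_cancel_left' minus_diff_eq)
  ultimately obtain B where B: "B \<ge> 0" "\<And>m. norm (b m) \<le> B * real (Suc m)"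
    using linear_growth[of b] by auto
  have lin: "norm (of_int l + a m) \<le> (\<bar>of_int l\<bar> + A) * real (Suc m)" for l m
  proof -
    have "norm (of_int l + a m) \<le> \<bar>of_int l\<bar> + A * real (Suc m)"
      by (rule norm_triangle_le) (use A in auto)
    also have "\<dots> \<le> \<bar>of_int l\<bar> * real (Suc m) + A * real (Suc m)"
      using mult_left_mono[of 1 "real (Suc m)" "\<bar>of_int l\<bar>"] by simp
    finally show ?thesis by (simp add: algebra_simps)
  qed
  have sq: "real (Suc m) \<le> (real (Suc m))\<^sup>2" for m
    by (simp add: power2_eq_square)
  show "series_solution q (\<lambda>l m. (of_int l + a m) * (c m * X m powi l))"
    unfolding X
  proof (rule series_solution_weighted)
    show "\<exists>K. \<forall>m. norm (of_int l + a m) \<le> K * (real (Suc m))\<^sup>2" for l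
      using lin[of l] mult_left_mono[OF sq, of "\<bar>of_int l\<bar> + A"] A(1)
      by (intro exI[of _ "\<bar>of_int l\<bar> + A"] allI) (auto intro: order_trans)
    show "const_op q (\<lambda>l. (of_int l + a (Suc m)) * (- 1 * q ^ Suc m) powi l) l =
      (- 1 * q ^ Suc m) powi l * charpoly q (- 1 * q ^ Suc m) * (of_int (l + 4) + a m)" for l m
      using a[of m] nz[of m] q unfolding X
      by (subst const_op_linear_weight) (auto simp: add_ac)
  qed (use assms in \<open>auto simp: const_op_triple_root\<close>)
  show "series_solution q (\<lambda>l m. ((of_int l + a m)\<^sup>2 + b m) * (c m * X m powi l))"
    unfolding X
  proof (rule series_solution_weighted)
    fix l
    have "norm ((of_int l + a m)\<^sup>2 + b m) \<le> ((\<bar>of_int l\<bar> + A)\<^sup>2 + B) * (real (Suc m))\<^sup>2" for m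
    proof -
      have "norm ((of_int l + a m)\<^sup>2 + b m) \<le> (norm (of_int l + a m))\<^sup>2 + norm (b m)"
        by (metis norm_triangle_ineq norm_power)
      also have "\<dots> \<le> ((\<bar>of_int l\<bar> + A) * real (Suc m))\<^sup>2 + B * (real (Suc m))\<^sup>2"
        using power_mono[OF lin] order_trans[OF B(2) mult_left_mono[OF sq B(1)]]
        by (intro add_mono) auto
      finally show ?thesis by (simp only: power_mult_distrib distrib_right[of "(\<bar>of_int l\<bar> + A)\<^sup>2"])
    qed
    thus "\<exists>K. \<forall>m. norm ((of_int l + a m)\<^sup>2 + b m) \<le> K * (real (Suc m))\<^sup>2" by blast
  next
    fix l m
    have e: "of_int l + a (Suc m) + theta_log q (X (Suc m)) = of_int (l + 4) + a m"
      using a[of m] by (auto simp: algebra_simps)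
    have X_nz: "X (Suc m) \<noteq> 0" using q(1) by (simp add: X)
    show "const_op q (\<lambda>l. ((of_int l + a (Suc m))\<^sup>2 + b (Suc m)) * (- 1 * q ^ Suc m) powi l) l =
      (- 1 * q ^ Suc m) powi l * charpoly q (- 1 * q ^ Suc m) * ((of_int (l + 4) + a m)\<^sup>2 + b m)"
      using const_op_quadratic_weight[OF X_nz nz[of m], of "a (Suc m)" "b (Suc m)" l]
      unfolding e add.assoc[of _ "b (Suc m)"] b unfolding X .
  qed (use assms in \<open>auto simp: const_op_triple_root\<close>)
qed


text \<open>
  This absorbs the normalizations that occur in practice: a factor \<open>\<sigma>\<close> that is the same for all terms
  of the series but may depend on \<open>\<lambda>\<close>, such as the sign \<open>(-1)\<^sup>\<lambda>\<close>, and a constant \<open>K\<close> in front of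
  the whole solution.
\<close>

lemma series_solution_rescale:
  assumes F: "series_solution q F"
    and FG: "\<And>l m. F l m = \<sigma> l * G l m" and nz: "\<And>l. \<sigma> l \<noteq> 0"
    and y: "\<And>l. y l = K * (\<sigma> l * suminf (G l))"
  shows "solves_at q y l"
proof -
  have sm: "summable (\<lambda>m. \<sigma> l * G l m)" for l
    using F unfolding series_solution_def by (simp add: FG[symmetric])
  have "\<sigma> l * suminf (G l) = suminf (F l)" for l
    using suminf_mult[OF summable_mult_D[OF sm[of l] nz[of l]], of "\<sigma> l"] by (simp add: FG[symmetric])
  hence "y = (\<lambda>l. K * suminf (F l))" using y by auto
  thus ?thesis
    using F const_op_cmult[of q K "\<lambda>l. suminf (F l)" l]
    unfolding series_solution_def solves_at_def by simp
qed

section \<open>The q-hypergeometric coefficients\<close>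

text \<open>
  With \<open>h = q\<^sup>1\<^sup>/\<^sup>2\<close>, the cases \<open>j = 0, 3, 4, 5\<close> are the members \<open>(s, e) = (1, 0), (1, 1), (-1, 0), (-1, 1)\<close>
  of one family: \<open>s\<close> is the sign in the squared Pochhammer symbol, and \<open>e = 1\<close> marks the series in
  half-integral powers of \<open>q\<close>. All exponents are expressed through \<open>h\<close>, which turns the
  half-integral powers into integral ones.
\<close>

lemma qpoch_Suc: "qpoch a q (Suc m) = qpoch a q m * (1 - a * q ^ m)"
  by (simp add: qpoch_def)

definition node :: "complex \<Rightarrow> nat \<Rightarrow> complex \<Rightarrow> nat \<Rightarrow> complex" where
  "node s e h m = - s * h ^ (2 * m + e)"

definition qden :: "complex \<Rightarrow> nat \<Rightarrow> complex \<Rightarrow> nat \<Rightarrow> complex" where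
  "qden s e h m = (qpoch (s * h ^ (2 + e)) (h\<^sup>2) m)\<^sup>2 * qpoch (h\<^sup>2) (h\<^sup>2) (2 * m + e)"

text \<open>
  For \<open>e = 1\<close> the coefficients of \<open>H\<^sup>+\<close> and \<open>H\<^sup>-\<close> are reproduced up to factors independent of
  \<open>m\<close> and \<open>\<lambda>\<close>. The argument \<open>h\<close> of \<open>coeff_minus\<close> stands for a square root of \<open>1 / q\<close>.
\<close>

definition coeff_plus :: "complex \<Rightarrow> nat \<Rightarrow> complex \<Rightarrow> nat \<Rightarrow> complex" where
  "coeff_plus s e h m = h ^ (2 * m * (2 * m + 1 + 2 * e)) / qden s e h m"

definition coeff_minus :: "complex \<Rightarrow> nat \<Rightarrow> complex \<Rightarrow> nat \<Rightarrow> complex" where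
  "coeff_minus s e h m = h ^ (2 * m * (m + 1 + e)) / qden s e h m"

lemma qden_Suc:
  "qden s e h (Suc m) = qden s e h m * ((1 - s * h ^ (2 * m + 2 + e))\<^sup>2
     * (1 - h ^ (4 * m + 2 + 2 * e)) * (1 - (h ^ (2 * m + 2 + e))\<^sup>2))"
proof -
  have "s * h ^ (2 + e) * (h\<^sup>2) ^ m = s * h ^ (2 * m + 2 + e)"
    by (simp add: power_mult[symmetric] power_add mult_ac)
  moreover have "h\<^sup>2 * (h\<^sup>2) ^ (2 * m + e) = h ^ (4 * m + 2 + 2 * e)"
    by (simp add: power_mult[symmetric] power_add[symmetric] algebra_simps)
  moreover have "h\<^sup>2 * (h\<^sup>2) ^ Suc (2 * m + e) = (h ^ (2 * m + 2 + e))\<^sup>2"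
    by (simp only: power_mult[symmetric] power_add[symmetric]) (simp add: algebra_simps)
  moreover have "2 * Suc m + e = Suc (Suc (2 * m + e))" by simp
  ultimately show ?thesis
    unfolding qden_def by (simp only: qpoch_Suc power_mult_distrib mult_ac)
qed

lemma power_ne_1:
  fixes h :: complex
  assumes "norm h \<noteq> 1" "0 < k"
  shows "h ^ k \<noteq> 1"
  using assms power_eq_1_iff[of h k] by auto

lemma sign_power_ne:
  fixes h s :: complex
  assumes "norm h \<noteq> 1" "0 < k" "s\<^sup>2 = 1"
  shows "1 - s * h ^ k \<noteq> 0"
proof
  assume "1 - s * h ^ k = 0"
  hence "s * h ^ k = 1" by simp
  moreover have "h ^ k = s * (s * h ^ k)"
    using assms(3) by (simp add: power2_eq_square mult.assoc[symmetric])
  ultimately have "h ^ k = s" by simp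
  hence "h ^ (k * 2) = 1" using assms(3) by (simp add: power_mult)
  thus False using power_ne_1[OF assms(1), of "k * 2"] assms(2) by simp
qed

lemma step_factors_nonzero:
  fixes h s :: complex
  assumes "norm h \<noteq> 1" "s\<^sup>2 = 1"
  shows "1 - s * h ^ (2 * m + 2 + e) \<noteq> 0"
    and "1 - h ^ (4 * m + 2 + 2 * e) \<noteq> 0"
    and "1 - (h ^ (2 * m + 2 + e))\<^sup>2 \<noteq> 0"
proof -
  show "1 - s * h ^ (2 * m + 2 + e) \<noteq> 0"
    using assms by (intro sign_power_ne) auto
  have "h ^ (4 * m + 2 + 2 * e) \<noteq> 1" by (intro power_ne_1 assms) simp
  thus "1 - h ^ (4 * m + 2 + 2 * e) \<noteq> 0" by simp
  have "h ^ ((2 * m + 2 + e) * 2) \<noteq> 1" by (intro power_ne_1 assms) simp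
  thus "1 - (h ^ (2 * m + 2 + e))\<^sup>2 \<noteq> 0" by (simp only: right_minus_eq power_mult)
qed

text \<open>
  The three new factors of the denominator in \<open>qden_Suc\<close> are the factors of \<open>Q\<close> at the new node; the
  second factor matches \<open>q - X\<^sup>2\<close> only up to \<open>q\<close>. This is why the recurrence holds.
\<close>

lemma charpoly_node:
  assumes "s\<^sup>2 = 1"
  shows "charpoly (h\<^sup>2) (node s e h (Suc m)) = (1 - s * h ^ (2 * m + 2 + e))\<^sup>2
     * (1 - (h ^ (2 * m + 2 + e))\<^sup>2) * (h\<^sup>2 * (1 - h ^ (4 * m + 2 + 2 * e)))"
proof -
  have "node s e h (Suc m) = - s * h ^ (2 * m + 2 + e)" by (simp add: node_def)
  moreover have "(h ^ (2 * m + 2 + e))\<^sup>2 = h\<^sup>2 * h ^ (4 * m + 2 + 2 * e)"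
    by (simp only: power_mult[symmetric] power_add[symmetric]) (simp add: algebra_simps)
  ultimately show ?thesis
    unfolding charpoly_def using assms by (simp add: power_mult_distrib right_diff_distrib)
qed

lemma charpoly_node_nonzero:
  assumes "h \<noteq> 0" "norm h \<noteq> 1" "s\<^sup>2 = 1"
  shows "charpoly (h\<^sup>2) (node s e h (Suc m)) \<noteq> 0"
  unfolding charpoly_node[OF assms(3)] mult_eq_0_iff power_eq_0_iff
  using step_factors_nonzero[OF assms(2,3)] assms(1) by metis

lemma coeff_plus_step:
  assumes "norm h \<noteq> 1" "s\<^sup>2 = 1"
  shows "coeff_plus s e h (Suc m) * charpoly (h\<^sup>2) (node s e h (Suc m))
     = coeff_plus s e h m * node s e h (Suc m) ^ 4"
proof -
  define x y where "x = h ^ (2 * m + 2 + e)" and "y = h ^ (4 * m + 2 + 2 * e)"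
  have xy: "x\<^sup>2 = h\<^sup>2 * y"
    unfolding x_def y_def
    by (simp only: power_mult[symmetric] power_add[symmetric]) (simp add: algebra_simps)
  have nz: "1 - s * x \<noteq> 0" "1 - y \<noteq> 0" "1 - x\<^sup>2 \<noteq> 0"
    unfolding x_def y_def by (rule step_factors_nonzero[OF assms])+
  have "h ^ (2 * Suc m * (2 * Suc m + 1 + 2 * e)) = h ^ (2 * m * (2 * m + 1 + 2 * e)) * (x\<^sup>2 * y)"
    unfolding x_def y_def
    by (simp only: power_mult[symmetric] power_add[symmetric]) (simp add: algebra_simps)
  moreover have "node s e h (Suc m) ^ 4 = x\<^sup>2 * y * h\<^sup>2"
  proof -
    have "node s e h (Suc m) = - s * x" by (simp add: node_def x_def)
    thus ?thesis using assms(2) xy by simp algebra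
  qed
  ultimately show ?thesis
    unfolding coeff_plus_def qden_Suc charpoly_node[OF assms(2)] x_def[symmetric] y_def[symmetric]
    using nz by simp
qed

text \<open>
  Here the nodes are powers of \<open>h\<close> while the coefficients are built from \<open>u = 1 / h\<close>. In terms of
  \<open>x = u\<^sup>k\<close> the node is \<open>- s / x\<close>, and \<open>s\<^sup>2 = 1\<close> allows each factor of \<open>Q\<close> to be rewritten in \<open>x\<close>, at the
  price of the common factor \<open>x\<^sup>-\<^sup>6\<close>; this factor accounts for the different exponents in
  \<open>coeff_plus\<close> and \<open>coeff_minus\<close>.
\<close>

lemma coeff_minus_step:
  assumes "h \<noteq> 0" "norm h \<noteq> 1" "s\<^sup>2 = 1"
  shows "coeff_minus s e (inverse h) (Suc m) * charpoly (h\<^sup>2) (node s e h (Suc m))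
     = coeff_minus s e (inverse h) m * node s e h (Suc m) ^ 4"
proof -
  define u where "u = inverse h"
  have u: "u \<noteq> 0" "norm u \<noteq> 1" and h: "h = inverse u"
    using assms by (auto simp: u_def norm_inverse)
  define x y where "x = u ^ (2 * m + 2 + e)" and "y = u ^ (4 * m + 2 + 2 * e)"
  have xy: "x\<^sup>2 = u\<^sup>2 * y"
    unfolding x_def y_def
    by (simp only: power_mult[symmetric] power_add[symmetric]) (simp add: algebra_simps)
  have x0: "x \<noteq> 0" "y \<noteq> 0" using u by (auto simp: x_def y_def)
  have nz: "1 - s * x \<noteq> 0" "1 - y \<noteq> 0" "1 - x\<^sup>2 \<noteq> 0"
    unfolding x_def y_def by (rule step_factors_nonzero[OF u(2) assms(3)])+
  have num: "u ^ (2 * Suc m * (Suc m + 1 + e)) = u ^ (2 * m * (m + 1 + e)) * x\<^sup>2"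
    unfolding x_def y_def
    by (simp only: power_mult[symmetric] power_add[symmetric]) (simp add: algebra_simps)
  have node: "node s e h (Suc m) = - s / x"
    by (simp add: node_def x_def h power_inverse divide_inverse)
  define w where "w = x ^ 4"
  have w: "x ^ 6 = x\<^sup>2 * w" "w \<noteq> 0" using x0 by (simp_all add: w_def)
  have "s ^ 4 = 1" using assms(3) by algebra
  hence "node s e h (Suc m) ^ 4 = 1 / w"
    unfolding node w_def by (simp add: power_divide)
  moreover have "charpoly (h\<^sup>2) (node s e h (Suc m)) = (1 - s * x)\<^sup>2 * (1 - x\<^sup>2) * (1 - y) / (x\<^sup>2 * w)"
  proof -
    have "1 + - s / x = - s * (1 - s * x) / x" "1 - (- s / x)\<^sup>2 = (1 - x\<^sup>2) * (- 1 / x\<^sup>2)"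
      "h\<^sup>2 - (- s / x)\<^sup>2 = (1 - y) * (- 1 / x\<^sup>2)"
    proof -
      show "1 + - s / x = - s * (1 - s * x) / x"
        using assms(3) x0 by (simp add: field_simps power2_eq_square)
      show "1 - (- s / x)\<^sup>2 = (1 - x\<^sup>2) * (- 1 / x\<^sup>2)"
        using assms(3) x0 by (simp add: field_simps power_divide)
      have "h\<^sup>2 = y / x\<^sup>2"
        using xy x0 u by (simp add: h power_inverse field_simps)
      thus "h\<^sup>2 - (- s / x)\<^sup>2 = (1 - y) * (- 1 / x\<^sup>2)"
        using assms(3) x0 by (simp add: power_divide diff_divide_distrib)
    qed
    thus ?thesis
      unfolding charpoly_def node w(1)[symmetric] using assms(3)
      by (simp add: power_mult_distrib power_divide power_add[symmetric])
  qed
  ultimately show ?thesis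
    unfolding coeff_minus_def u_def[symmetric] qden_Suc num x_def[symmetric] y_def[symmetric]
    using nz x0 w(2) by simp
qed

lemma node_geometric: "node s e h m = node s e h 0 * (h\<^sup>2) ^ m"
  by (simp add: node_def power_add power_mult[symmetric])

text \<open>
  The initial node \<open>- s h\<^sup>e\<close> is a root of \<open>1 - X\<^sup>2\<close> if \<open>e = 0\<close> and of \<open>q - X\<^sup>2\<close> if \<open>e = 1\<close>.
\<close>

lemma hypergeometric_node:
  assumes h: "h \<noteq> 0" "norm h \<noteq> 1" and s: "s\<^sup>2 = 1" and "e \<le> 1"
    and c: "\<And>m. c (Suc m) * charpoly (h\<^sup>2) (node s e h (Suc m)) = c m * node s e h (Suc m) ^ 4"
  shows "series_solution (h\<^sup>2) (\<lambda>l m. c m * node s e h m powi l)"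
proof -
  have "norm (h\<^sup>2) \<noteq> 1"
    using h(2) by (simp add: norm_power power2_eq_1_iff) (metis norm_ge_zero not_one_le_zero neg_0_le_iff_le zero_le_one order_trans)
  moreover have "node s e h 0 \<noteq> 0" using h s by (auto simp: node_def)
  moreover have "e = 0 \<or> e = 1" using \<open>e \<le> 1\<close> by auto
  hence "charpoly (h\<^sup>2) (node s e h 0) = 0"
    using s by (auto simp: node_def charpoly_def power_mult_distrib)
  moreover note charpoly_node_nonzero[OF h s] c
  ultimately show ?thesis
    using series_solution_hypergeometric[of "h\<^sup>2" "node s e h 0" c] h(1)
    by (simp add: node_geometric[symmetric] del: power_Suc)
qed

section \<open>The Lambert series in the weights\<close>

lemma norm_one_minus_power_ge:
  fixes p :: complex
  assumes "norm p < 1"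
  shows "1 - norm p \<le> norm (1 - p ^ Suc s)"
proof -
  have "norm (p ^ Suc s) \<le> norm p"
    using assms mult_left_mono[OF power_le_one[of "norm p" s], of "norm p"]
    by (simp add: norm_mult norm_power)
  thus ?thesis using norm_triangle_ineq2[of 1 "p ^ Suc s"] by simp
qed

lemma Eser_summable:
  fixes p :: complex
  assumes p: "norm p < 1" and "l \<le> 2"
  shows "summable (\<lambda>s. of_nat (Suc s) ^ (l - 1) * p ^ (Suc s * (m + 1)) / (1 - p ^ Suc s))"
proof (rule summable_comparison_test'[where N = 0])
  show "summable (\<lambda>s. real (Suc s) * norm p ^ s / (1 - norm p))"
    using geometric_deriv_sums[of "norm p"] p by (intro summable_divide) (auto simp: sums_iff)
next
  fix s
  have "norm (of_nat (Suc s) ^ (l - 1) :: complex) \<le> real (Suc s)"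
    using power_increasing[of "l - 1" 1 "real (Suc s)"] \<open>l \<le> 2\<close>
    by (simp add: norm_power del: of_nat_Suc)
  moreover have "norm (p ^ (Suc s * (m + 1))) \<le> norm p ^ s"
    unfolding norm_power using p by (intro power_decreasing) auto
  ultimately show "norm (of_nat (Suc s) ^ (l - 1) * p ^ (Suc s * (m + 1)) / (1 - p ^ Suc s))
      \<le> real (Suc s) * norm p ^ s / (1 - norm p)"
    unfolding norm_divide norm_mult using p norm_one_minus_power_ge[OF p, of s]
    by (intro frac_le mult_mono) auto
qed

text \<open>
  Raising the index multiplies the \<open>s\<close>-th summand by \<open>q\<^sup>s\<close>, so that the difference cancels the
  denominator \<open>1 - q\<^sup>s\<close> and leaves a geometric series or its derivative.
\<close>

lemma Eser_diff:
  fixes p :: complex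
  assumes p: "norm p < 1" and "l \<le> 2"
  shows "Eser l m p - Eser l (Suc m) p = (\<Sum>s. of_nat (Suc s) ^ (l - 1) * (p ^ Suc m) ^ Suc s)"
proof -
  have "Eser l m p - Eser l (Suc m) p
     = (\<Sum>s. of_nat (Suc s) ^ (l - 1) * p ^ (Suc s * (m + 1)) / (1 - p ^ Suc s)
        - of_nat (Suc s) ^ (l - 1) * p ^ (Suc s * (Suc m + 1)) / (1 - p ^ Suc s))"
    unfolding Eser_def by (intro suminf_diff Eser_summable assms)
  also have "\<dots> = (\<Sum>s. of_nat (Suc s) ^ (l - 1) * (p ^ Suc m) ^ Suc s)"
  proof (rule suminf_cong)
    fix s
    have "1 - p ^ Suc s \<noteq> 0"
      using norm_one_minus_power_ge[OF p, of s] p by auto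
    moreover have "p ^ (Suc s * (Suc m + 1)) = p ^ Suc s * p ^ (Suc s * (m + 1))"
      by (simp only: power_add[symmetric]) (simp add: algebra_simps)
    moreover have "(p ^ Suc m) ^ Suc s = p ^ (Suc s * (m + 1))"
      by (simp only: power_mult[symmetric]) (simp add: mult_ac)
    ultimately show "of_nat (Suc s) ^ (l - 1) * p ^ (Suc s * (m + 1)) / (1 - p ^ Suc s)
        - of_nat (Suc s) ^ (l - 1) * p ^ (Suc s * (Suc m + 1)) / (1 - p ^ Suc s)
       = of_nat (Suc s) ^ (l - 1) * (p ^ Suc m) ^ Suc s"
      by (simp only: diff_divide_distrib[symmetric]) (simp add: divide_simps algebra_simps del: power_Suc)
  qed
  finally show ?thesis .
qed

lemma
  fixes p :: complex
  assumes p: "norm p < 1"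
  shows Eser_1_Suc: "Eser 1 (Suc m) p = Eser 1 m p - p ^ Suc m / (1 - p ^ Suc m)"
    and Eser_2_Suc: "Eser 2 (Suc m) p = Eser 2 m p - p ^ Suc m / (1 - p ^ Suc m)\<^sup>2"
proof -
  define z where "z = p ^ Suc m"
  have z: "norm z < 1"
    using p mult_left_mono[OF power_le_one[of "norm p" m], of "norm p"]
    by (simp add: z_def norm_mult norm_power)
  have "(\<lambda>s. z * z ^ s) sums (z * (1 / (1 - z)))"
    by (intro sums_mult geometric_sums z)
  thus "Eser 1 (Suc m) p = Eser 1 m p - p ^ Suc m / (1 - p ^ Suc m)"
    using Eser_diff[OF p, of 1 m] unfolding z_def[symmetric]
    by (simp add: sums_iff algebra_simps)
  have "(\<lambda>s. z * (of_nat (Suc s) * z ^ s)) sums (z * (1 / (1 - z)\<^sup>2))"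
    by (intro sums_mult geometric_deriv_sums z)
  thus "Eser 2 (Suc m) p = Eser 2 m p - p ^ Suc m / (1 - p ^ Suc m)\<^sup>2"
    using Eser_diff[OF p, of 2 m] unfolding z_def[symmetric]
    by (simp add: sums_iff algebra_simps del: of_nat_Suc)
qed


text \<open>
  At the nodes for \<open>j \<le> 2\<close> the factors of \<open>Q\<close> contribute exactly the increments of
  \<open>E\<^sub>1\<close> and \<open>E\<^sub>2\<close>: \<open>(1 + X)\<^sup>2\<close> gives the one from \<open>m\<close> to \<open>m + 1\<close>, while \<open>q - X\<^sup>2\<close> and
  \<open>1 - X\<^sup>2\<close> give the two from \<open>2 m\<close> to \<open>2 m + 2\<close>.
\<close>

lemma theta_log_at_power:
  assumes "q \<noteq> 0"
  shows "theta_log q (- (q ^ Suc m)) = - 2 * (q ^ Suc m / (1 - q ^ Suc m))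
     - 2 * (q ^ Suc (2 * m) / (1 - q ^ Suc (2 * m)))
     - 2 * (q ^ Suc (Suc (2 * m)) / (1 - q ^ Suc (Suc (2 * m))))"
    and "theta2_log q (- (q ^ Suc m)) = - 2 * (q ^ Suc m / (1 - q ^ Suc m)\<^sup>2)
     - 4 * (q ^ Suc (2 * m) / (1 - q ^ Suc (2 * m))\<^sup>2)
     - 4 * (q ^ Suc (Suc (2 * m)) / (1 - q ^ Suc (Suc (2 * m)))\<^sup>2)"
proof -
  define z w where "z = q ^ Suc m" and "w = q ^ Suc (2 * m)"
  have zz: "(- z)\<^sup>2 = q * w"
    by (simp add: z_def w_def power2_eq_square power_add[symmetric] mult_2)
  have w2: "q ^ Suc (Suc (2 * m)) = q * w" by (simp add: w_def)
  have qw: "q - q * w = q * (1 - w)" by (simp add: algebra_simps)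
  show "theta_log q (- (q ^ Suc m)) = - 2 * (q ^ Suc m / (1 - q ^ Suc m))
     - 2 * (q ^ Suc (2 * m) / (1 - q ^ Suc (2 * m)))
     - 2 * (q ^ Suc (Suc (2 * m)) / (1 - q ^ Suc (Suc (2 * m))))"
    unfolding w2 w_def[symmetric] z_def[symmetric] theta_log_def zz qw using assms by simp
  have "4 * q * (q * w) / (q * (1 - w))\<^sup>2 = 4 * (w / (1 - w)\<^sup>2)"
    using assms by (simp add: power_mult_distrib power2_eq_square)
  thus "theta2_log q (- (q ^ Suc m)) = - 2 * (q ^ Suc m / (1 - q ^ Suc m)\<^sup>2)
     - 4 * (q ^ Suc (2 * m) / (1 - q ^ Suc (2 * m))\<^sup>2)
     - 4 * (q ^ Suc (Suc (2 * m)) / (1 - q ^ Suc (Suc (2 * m)))\<^sup>2)"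
    unfolding w2 w_def[symmetric] z_def[symmetric] theta2_log_def zz qw by simp
qed

text \<open>
  The \<open>\<lambda>\<close>-independent parts of the weights in \<open>H\<^sup>+\<close> and \<open>H\<^sup>-\<close>. For \<open>H\<^sup>-\<close> the overall sign reflects
  that it enters with \<open>- \<lambda>\<close> in place of \<open>\<lambda>\<close>. In \<open>quad_shift\<close> the constant \<open>K\<close> is arbitrary, because
  the recurrence determines this sequence only up to a constant; the Eisenstein series is such a
  constant.
\<close>

definition shift_plus :: "complex \<Rightarrow> nat \<Rightarrow> complex" where
  "shift_plus q m = 4 * of_nat m + 1 - 2 * Eser 1 m q - 2 * Eser 1 (2 * m) q"

definition shift_minus :: "complex \<Rightarrow> nat \<Rightarrow> complex" where
  "shift_minus p m = - (2 * of_nat m + 1 - 2 * Eser 1 m p - 2 * Eser 1 (2 * m) p)"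

definition quad_shift :: "complex \<Rightarrow> complex \<Rightarrow> nat \<Rightarrow> complex" where
  "quad_shift K p m = K - 2 * Eser 2 m p - 4 * Eser 2 (2 * m) p"

lemma weight_steps_plus:
  assumes "q \<noteq> 0" "norm q < 1"
  shows "shift_plus q (Suc m) + theta_log q (- (q ^ Suc m)) = shift_plus q m + 4"
    and "quad_shift K q (Suc m) + theta2_log q (- (q ^ Suc m)) = quad_shift K q m"
proof -
  have S: "2 * Suc m = Suc (Suc (2 * m))" by simp
  show "shift_plus q (Suc m) + theta_log q (- (q ^ Suc m)) = shift_plus q m + 4"
    unfolding shift_plus_def theta_log_at_power[OF assms(1)] S Eser_1_Suc[OF assms(2)]
    by (simp add: algebra_simps del: power_Suc)
  show "quad_shift K q (Suc m) + theta2_log q (- (q ^ Suc m)) = quad_shift K q m"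
    unfolding quad_shift_def theta_log_at_power[OF assms(1)] S Eser_2_Suc[OF assms(2)]
    by (simp add: algebra_simps del: power_Suc)
qed

text \<open>
  With \<open>w = q\<^sup>k\<close>, the inversion \<open>w \<mapsto> 1 / w\<close> sends \<open>w / (1 - w)\<close> to \<open>- 1 - w / (1 - w)\<close> and fixes
  \<open>w / (1 - w)\<^sup>2\<close>. The three constants \<open>-1\<close>, each with factor 2, turn the slope \<open>4\<close> of
  \<open>shift_plus\<close> into the slope \<open>-2\<close> of \<open>shift_minus\<close>.
\<close>

lemma weight_steps_minus:
  assumes "q \<noteq> 0" "norm q > 1"
  shows "shift_minus (inverse q) (Suc m) + theta_log q (- (q ^ Suc m)) = shift_minus (inverse q) m + 4"
    and "quad_shift K (inverse q) (Suc m) + theta2_log q (- (q ^ Suc m)) = quad_shift K (inverse q) m"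
proof -
  define p where "p = inverse q"
  have p: "norm p < 1" using assms by (simp add: p_def norm_inverse inverse_less_1_iff)
  have S: "2 * Suc m = Suc (Suc (2 * m))" by simp
  have inv: "p ^ Suc k / (1 - p ^ Suc k) = - 1 - q ^ Suc k / (1 - q ^ Suc k)"
    "p ^ Suc k / (1 - p ^ Suc k)\<^sup>2 = q ^ Suc k / (1 - q ^ Suc k)\<^sup>2" for k
  proof -
    define w where "w = q ^ Suc k"
    have "w \<noteq> 1" unfolding w_def using assms by (intro power_ne_1) auto
    moreover have "w \<noteq> 0" using assms by (simp add: w_def)
    moreover have "p ^ Suc k = 1 / w"
      by (simp add: w_def p_def power_inverse[symmetric] divide_inverse)
    moreover have "1 - 1 / w = (w - 1) / w" using \<open>w \<noteq> 0\<close> by (simp add: field_simps)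
    ultimately show "p ^ Suc k / (1 - p ^ Suc k) = - 1 - q ^ Suc k / (1 - q ^ Suc k)"
      "p ^ Suc k / (1 - p ^ Suc k)\<^sup>2 = q ^ Suc k / (1 - q ^ Suc k)\<^sup>2"
      unfolding w_def[symmetric]
      by (simp_all add: power_divide power2_commute[of w 1])
        (simp_all add: divide_simps power2_eq_square)
  qed
  show "shift_minus (inverse q) (Suc m) + theta_log q (- (q ^ Suc m)) = shift_minus (inverse q) m + 4"
    unfolding p_def[symmetric] shift_minus_def theta_log_at_power[OF assms(1)] S Eser_1_Suc[OF p] inv
    by (simp add: algebra_simps del: power_Suc)
  show "quad_shift K (inverse q) (Suc m) + theta2_log q (- (q ^ Suc m)) = quad_shift K (inverse q) m"
    unfolding p_def[symmetric] quad_shift_def theta_log_at_power[OF assms(1)] S Eser_2_Suc[OF p] inv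
    by (simp add: algebra_simps del: power_Suc)
qed

section \<open>The functions of the theorem\<close>

text \<open>
  The terms of \<open>H\<^sup>+\<close> and \<open>H\<^sup>-\<close> with all powers of \<open>q\<close> written as integral powers of \<open>h = q\<^sup>1\<^sup>/\<^sup>2\<close> and
  without the sign that is raised to the power \<open>\<lambda>\<close>. The weights for \<open>j = 1, 2\<close> and factors common to
  all terms are split off.
\<close>

definition plus_term :: "complex \<Rightarrow> nat \<Rightarrow> complex \<Rightarrow> int \<Rightarrow> nat \<Rightarrow> complex" where
  "plus_term s e h l m =
     h powi (int (2 * m * (2 * m + 1 + 2 * e)) + l * int (2 * m + e)) / qden s e h m"

definition minus_term :: "complex \<Rightarrow> nat \<Rightarrow> complex \<Rightarrow> int \<Rightarrow> nat \<Rightarrow> complex" where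
  "minus_term s e h l m =
     h powi (int (2 * m * (m + 1 + e)) + l * int (2 * m + e)) / qden s e h m"

lemma power_int_affine:
  fixes z :: complex
  assumes "z \<noteq> 0"
  shows "z powi (int a + l * int b) = z ^ a * (z ^ b) powi l"
  using assms by (simp add: power_int_add power_int_mult mult.commute[of l])

lemma plus_term_eq:
  assumes "h \<noteq> 0"
  shows "coeff_plus s e h m * node s e h m powi l = (- s) powi l * plus_term s e h l m"
  unfolding coeff_plus_def node_def plus_term_def power_int_affine[OF assms] power_int_mult_distrib
  by simp

lemma minus_term_eq:
  assumes "h \<noteq> 0"
  shows "coeff_minus s e (inverse h) m * node s e h m powi l
     = (- s) powi l * minus_term s e (inverse h) (- l) m"
proof -
  have "inverse h \<noteq> 0" using assms by simp
  moreover have "(inverse h ^ k) powi (- l) = (h ^ k) powi l" for k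
    by (simp add: power_int_minus power_inverse power_int_inverse)
  ultimately show ?thesis
    unfolding coeff_minus_def node_def minus_term_def power_int_affine[OF \<open>inverse h \<noteq> 0\<close>]
      power_int_mult_distrib by simp
qed

lemma qpow_nonzero: "qpow \<tau> r \<noteq> 0"
  by (simp add: qpow_def)

lemma qpow_half_int:
  assumes "2 * r = of_int k"
  shows "qpow \<tau> r = qpow \<tau> (1 / 2) powi k"
proof -
  have "complex_of_real r = of_int k / 2"
    using arg_cong[OF assms, of complex_of_real] by (simp add: mult.commute)
  thus ?thesis unfolding qpow_def exp_power_int by (simp add: mult_ac)
qed

lemma qpow_half_nat:
  assumes "2 * r = of_nat k"
  shows "qpow \<tau> r = qpow \<tau> (1 / 2) ^ k"
  using qpow_half_int[of r "int k"] assms by simp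

lemma nome_half: "nome \<tau> = (qpow \<tau> (1 / 2))\<^sup>2"
  by (rule qpow_half_nat) simp

text \<open>
  The factor \<open>h\<^sup>2\<close> for \<open>j = 3, 5\<close> comes from the constant part of the exponent, as
  \<open>2 (2 m + 1) (m + 1) = 2 m (2 m + 3) + 2\<close>.
\<close>

lemma Hplus_normal_form:
  fixes \<tau> :: complex
  defines "h \<equiv> qpow \<tau> (1 / 2)"
  shows "j \<le> 2 \<Longrightarrow> Hplus j l \<tau>
      = (-1) powi l * (\<Sum>m. plus_term 1 0 h l m * p_coeff j l m (nome \<tau>))"
    and "Hplus 3 l \<tau> = qpow \<tau> (1 / 8) / (1 - h)\<^sup>2
      * ((-1) powi l * (\<Sum>m. h\<^sup>2 * plus_term 1 1 h l m))"
    and "Hplus 4 l \<tau> = (\<Sum>m. plus_term (-1) 0 h l m)"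
    and "Hplus 5 l \<tau> = qpow \<tau> (1 / 8) / (1 + h)\<^sup>2 * (\<Sum>m. h\<^sup>2 * plus_term (-1) 1 h l m)"
proof -
  have h0: "h \<noteq> 0" by (simp add: h_def qpow_nonzero)
  have q: "nome \<tau> = h\<^sup>2" unfolding h_def by (rule nome_half)
  have q32: "qpow \<tau> (3 / 2) = h ^ 3" unfolding h_def by (rule qpow_half_nat) simp
  have sq: "(h\<^sup>2) powi k = h powi (2 * k)" for k by (simp add: power_int_mult)
  have integral: "(h\<^sup>2) powi (int m * (2 * int m + 1) + l * int m)
      = h powi (int (2 * m * (2 * m + 1 + 2 * 0)) + l * int (2 * m + 0))" for m
    unfolding sq by (rule arg_cong[where f = "power_int h"]) (simp add: algebra_simps)
  have half: "qpow \<tau> ((2 * real m + 1) * (real m + 1) + of_int l * (real m + 1 / 2))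
      = h\<^sup>2 * h powi (int (2 * m * (2 * m + 1 + 2 * 1)) + l * int (2 * m + 1))" for m
  proof -
    have "qpow \<tau> ((2 * real m + 1) * (real m + 1) + of_int l * (real m + 1 / 2))
      = h powi (2 + (int (2 * m * (2 * m + 1 + 2 * 1)) + l * int (2 * m + 1)))"
      unfolding h_def by (rule qpow_half_int) (simp add: algebra_simps)
    thus ?thesis using h0 by (simp add: power_int_add)
  qed
  show "j \<le> 2 \<Longrightarrow> Hplus j l \<tau>
      = (-1) powi l * (\<Sum>m. plus_term 1 0 h l m * p_coeff j l m (nome \<tau>))"
    unfolding Hplus_def plus_term_def qden_def q Let_def integral by simp
  have integral': "(h\<^sup>2) powi ((2 * int m + 1) * int m + l * int m)
      = h powi (int (2 * m * (2 * m + 1 + 2 * 0)) + l * int (2 * m + 0))" for m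
    using integral[of m] by (simp only: mult.commute[of "int m" "2 * int m + 1"])
  show "Hplus 4 l \<tau> = (\<Sum>m. plus_term (-1) 0 h l m)"
    unfolding Hplus_def plus_term_def qden_def q Let_def integral' by simp
  show "Hplus 3 l \<tau> = qpow \<tau> (1 / 8) / (1 - h)\<^sup>2
      * ((-1) powi l * (\<Sum>m. h\<^sup>2 * plus_term 1 1 h l m))"
    unfolding Hplus_def plus_term_def qden_def q q32 Let_def half h_def[symmetric] by simp
  show "Hplus 5 l \<tau> = qpow \<tau> (1 / 8) / (1 + h)\<^sup>2 * (\<Sum>m. h\<^sup>2 * plus_term (-1) 1 h l m)"
    unfolding Hplus_def plus_term_def qden_def q q32 Let_def half h_def[symmetric] by simp
qed

lemma Hminus_normal_form:
  fixes \<tau> :: complex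
  defines "h \<equiv> qpow \<tau> (1 / 2)"
  shows "j \<le> 2 \<Longrightarrow> Hminus j l \<tau>
      = (-1) powi l * (\<Sum>m. minus_term 1 0 h l m * P_coeff j l m (nome \<tau>))"
    and "Hminus 3 l \<tau> = qpow \<tau> (- 1 / 8) / (1 - qpow \<tau> (- 1 / 2))\<^sup>2
      * ((-1) powi l * (\<Sum>m. minus_term 1 1 h l m))"
    and "Hminus 4 l \<tau> = (\<Sum>m. minus_term (-1) 0 h l m)"
    and "Hminus 5 l \<tau> = qpow \<tau> (- 1 / 8) / (1 + qpow \<tau> (- 1 / 2))\<^sup>2
      * (\<Sum>m. minus_term (-1) 1 h l m)"
proof -
  have q: "nome \<tau> = h\<^sup>2" unfolding h_def by (rule nome_half)
  have q32: "qpow \<tau> (3 / 2) = h ^ 3" unfolding h_def by (rule qpow_half_nat) simp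
  have sq: "(h\<^sup>2) powi k = h powi (2 * k)" for k by (simp add: power_int_mult)
  have integral: "(h\<^sup>2) powi (int m * (int m + 1) + l * int m)
      = h powi (int (2 * m * (m + 1 + 0)) + l * int (2 * m + 0))" for m
    unfolding sq by (rule arg_cong[where f = "power_int h"]) (simp add: algebra_simps)
  have half: "qpow \<tau> (real m * (real m + 2) + of_int l * (real m + 1 / 2))
      = h powi (int (2 * m * (m + 1 + 1)) + l * int (2 * m + 1))" for m
    unfolding h_def by (rule qpow_half_int) (simp add: algebra_simps)
  show "j \<le> 2 \<Longrightarrow> Hminus j l \<tau>
      = (-1) powi l * (\<Sum>m. minus_term 1 0 h l m * P_coeff j l m (nome \<tau>))"
    unfolding Hminus_def minus_term_def qden_def q Let_def integral by simp
  show "Hminus 4 l \<tau> = (\<Sum>m. minus_term (-1) 0 h l m)"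
    unfolding Hminus_def minus_term_def qden_def q Let_def integral by simp
  show "Hminus 3 l \<tau> = qpow \<tau> (- 1 / 8) / (1 - qpow \<tau> (- 1 / 2))\<^sup>2
      * ((-1) powi l * (\<Sum>m. minus_term 1 1 h l m))"
    unfolding Hminus_def minus_term_def qden_def q q32 Let_def half by simp
  show "Hminus 5 l \<tau> = qpow \<tau> (- 1 / 8) / (1 + qpow \<tau> (- 1 / 2))\<^sup>2
      * (\<Sum>m. minus_term (-1) 1 h l m)"
    unfolding Hminus_def minus_term_def qden_def q q32 Let_def half by simp
qed

lemma node_at_1: "node 1 0 h m = - ((h\<^sup>2) ^ m)"
  by (simp add: node_def power_mult)

lemma series_solution_plus:
  assumes h: "h \<noteq> 0" "norm h \<noteq> 1" and s: "s\<^sup>2 = 1" and e: "e \<le> 1"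
  shows "series_solution (h\<^sup>2) (\<lambda>l m. (- s) powi l * plus_term s e h l m)"
  using hypergeometric_node[OF h s e coeff_plus_step[OF h(2) s]] by (simp add: plus_term_eq[OF h(1)])

lemma series_solution_minus:
  assumes h: "h \<noteq> 0" "norm h \<noteq> 1" and s: "s\<^sup>2 = 1" and e: "e \<le> 1"
  shows "series_solution (h\<^sup>2) (\<lambda>l m. (- s) powi l * minus_term s e (inverse h) (- l) m)"
  using hypergeometric_node[OF h s e coeff_minus_step[OF h s]] by (simp add: minus_term_eq[OF h(1)])

lemma frobenius_node:
  fixes h :: complex
  assumes h: "h \<noteq> 0" "norm h \<noteq> 1" "norm (h\<^sup>2) \<noteq> 1"
    and c: "\<And>m. c (Suc m) * charpoly (h\<^sup>2) (node 1 0 h (Suc m)) = c m * node 1 0 h (Suc m) ^ 4"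
    and a: "\<And>m. a (Suc m) + theta_log (h\<^sup>2) (- ((h\<^sup>2) ^ Suc m)) = a m + 4"
    and b: "\<And>m. b (Suc m) + theta2_log (h\<^sup>2) (- ((h\<^sup>2) ^ Suc m)) = b m"
  shows "series_solution (h\<^sup>2) (\<lambda>l m. (of_int l + a m) * (c m * node 1 0 h m powi l))"
    and "series_solution (h\<^sup>2) (\<lambda>l m. ((of_int l + a m)\<^sup>2 + b m) * (c m * node 1 0 h m powi l))"
proof -
  have q0: "h\<^sup>2 \<noteq> 0" using h(1) by simp
  have nz: "charpoly (h\<^sup>2) (- ((h\<^sup>2) ^ Suc m)) \<noteq> 0" for m
    unfolding node_at_1[symmetric] by (rule charpoly_node_nonzero[OF h(1,2)]) simp
  note sol = series_solution_frobenius[of "h\<^sup>2" c a b, OF q0 h(3) nz c[unfolded node_at_1] a b]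
  show "series_solution (h\<^sup>2) (\<lambda>l m. (of_int l + a m) * (c m * node 1 0 h m powi l))"
    unfolding node_at_1 by (rule sol(1))
  show "series_solution (h\<^sup>2) (\<lambda>l m. ((of_int l + a m)\<^sup>2 + b m) * (c m * node 1 0 h m powi l))"
    unfolding node_at_1 by (rule sol(2))
qed

lemma H_solution:
  assumes "j \<le> 5" "norm (nome \<tau>) \<noteq> 1"
  shows "solves_at (nome \<tau>) (\<lambda>l. H j l \<tau>) l"
proof -
  define h where "h = qpow \<tau> (1 / 2)"
  have q: "nome \<tau> = h\<^sup>2" unfolding h_def by (rule nome_half)
  have h: "h \<noteq> 0" "norm h \<noteq> 1" "norm (h\<^sup>2) \<noteq> 1"
    using assms(2) unfolding q by (auto simp: h_def qpow_nonzero norm_power)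
  have one: "1\<^sup>2 = (1::complex)" by simp
  have sign: "(-1) powi l \<noteq> (0::complex)" for l by simp
  consider "j = 0" | "j = 1" | "j = 2" | "j = 3" | "j = 4" | "j = 5" using assms(1) by linarith
  note j_cases = this
  show ?thesis
  proof (cases "norm (nome \<tau>) < 1")
    case True
    hence Heq: "H j l \<tau> = Hplus j l \<tau>" for j l by (simp add: H_def)
    note nf = Hplus_normal_form[where \<tau> = \<tau>, folded h_def, unfolded q]
    have q1: "h\<^sup>2 \<noteq> 0" "norm (h\<^sup>2) < 1" using True h(1) unfolding q by auto
    note frob = frobenius_node[OF h coeff_plus_step[OF h(2) one, of 0]
        weight_steps_plus(1)[OF q1] weight_steps_plus(2)[OF q1, of "- 1 / 3 * Eis2 (h\<^sup>2)"],
        unfolded plus_term_eq[OF h(1)]]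
    show ?thesis
      using j_cases
    proof cases
      case 1
      show ?thesis
        unfolding 1 Heq q
        by (rule series_solution_rescale[OF series_solution_plus[OF h(1,2), of 1 0], where K = 1,
              OF _ _ _ sign]) (auto simp: nf p_coeff_def)
    next
      case 2
      show ?thesis
        unfolding 2 Heq q
        by (rule series_solution_rescale[OF frob(1), where K = 1 and \<sigma> = "\<lambda>l. (-1) powi l"
              and G = "\<lambda>l m. plus_term 1 0 h l m * p_coeff 1 l m (h\<^sup>2)"])
          (auto simp: nf p_coeff_def p1_def shift_plus_def algebra_simps)
    next
      case 3
      show ?thesis
        unfolding 3 Heq q
        by (rule series_solution_rescale[OF frob(2), where K = 1 and \<sigma> = "\<lambda>l. (-1) powi l"
              and G = "\<lambda>l m. plus_term 1 0 h l m * p_coeff 2 l m (h\<^sup>2)"])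
          (auto simp: nf p_coeff_def p2_def p1_def shift_plus_def quad_shift_def algebra_simps)
    next
      case 4
      \<comment> \<open>The factor \<open>1 / h\<^sup>2\<close> in \<open>\<sigma>\<close> removes the \<open>h\<^sup>2\<close> inside the normal form of the sum.\<close>
      show ?thesis
        unfolding 4 Heq q
        by (rule series_solution_rescale[OF series_solution_plus[OF h(1,2), of 1 1],
            where \<sigma> = "\<lambda>l. (-1) powi l / h\<^sup>2" and G = "\<lambda>l m. h\<^sup>2 * plus_term 1 1 h l m"
              and K = "h\<^sup>2 * (qpow \<tau> (1 / 8) / (1 - h)\<^sup>2)"])
          (use h(1) in \<open>auto simp: nf\<close>)
    next
      case 5
      show ?thesis
        unfolding 5 Heq q
        by (rule series_solution_rescale[OF series_solution_plus[OF h(1,2), of "-1" 0],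
            where \<sigma> = "\<lambda>l. 1" and K = 1]) (auto simp: nf)
    next
      case 6
      show ?thesis
        unfolding 6 Heq q
        by (rule series_solution_rescale[OF series_solution_plus[OF h(1,2), of "-1" 1],
            where \<sigma> = "\<lambda>l. 1 / h\<^sup>2" and G = "\<lambda>l m. h\<^sup>2 * plus_term (-1) 1 h l m"
              and K = "h\<^sup>2 * (qpow \<tau> (1 / 8) / (1 + h)\<^sup>2)"])
          (use h(1) in \<open>auto simp: nf\<close>)
    qed
  next
    case False
    hence Heq: "H j l \<tau> = (-1) ^ delta j * Hminus j (- l) (- \<tau>)" for j l
      using assms(2) by (simp add: H_def)
    have u: "qpow (- \<tau>) (1 / 2) = inverse h"
      unfolding h_def qpow_def by (simp add: exp_minus)
    note nf = Hminus_normal_form[where \<tau> = "- \<tau>", unfolded u nome_uminus q]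
    have q1: "h\<^sup>2 \<noteq> 0" "norm (h\<^sup>2) > 1" using False h unfolding q by auto
    define K where "K = 12 * Eser 2 0 (inverse (h\<^sup>2)) - 1 / 2 + 1 / 3 * Eis2 (inverse (h\<^sup>2))"
    note frob = frobenius_node[OF h coeff_minus_step[OF h(1,2) one, of 0]
        weight_steps_minus(1)[OF q1] weight_steps_minus(2)[OF q1, of K],
        unfolded minus_term_eq[OF h(1)]]
    show ?thesis
      using j_cases
    proof cases
      case 1
      show ?thesis
        unfolding 1 Heq q
        by (rule series_solution_rescale[OF series_solution_minus[OF h(1,2), of 1 0], where K = 1,
              OF _ _ _ sign]) (auto simp: nf power_int_minus_one_minus P_coeff_def delta_def)
    next
      case 2
      show ?thesis
        unfolding 2 Heq q
        by (rule series_solution_rescale[OF frob(1), where K = 1 and \<sigma> = "\<lambda>l. - ((-1) powi l)"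
              and G = "\<lambda>l m. minus_term 1 0 (inverse h) (- l) m * P_coeff 1 (- l) m (inverse (h\<^sup>2))"])
          (auto simp: nf power_int_minus_one_minus P_coeff_def P1_def shift_minus_def delta_def algebra_simps)
    next
      case 3
      show ?thesis
        unfolding 3 Heq q
        by (rule series_solution_rescale[OF frob(2), where K = 1 and \<sigma> = "\<lambda>l. (-1) powi l"
              and G = "\<lambda>l m. minus_term 1 0 (inverse h) (- l) m * P_coeff 2 (- l) m (inverse (h\<^sup>2))"])
          (auto simp: nf power_int_minus_one_minus P_coeff_def P2_def P1_def shift_minus_def quad_shift_def K_def delta_def algebra_simps
             power2_eq_square)
    next
      case 4
      show ?thesis
        unfolding 4 Heq q
        by (rule series_solution_rescale[OF series_solution_minus[OF h(1,2), of 1 1],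
            where \<sigma> = "\<lambda>l. (-1) powi l" and G = "\<lambda>l. minus_term 1 1 (inverse h) (- l)"
              and K = "qpow (- \<tau>) (- 1 / 8) / (1 - qpow (- \<tau>) (- 1 / 2))\<^sup>2"])
          (auto simp: nf power_int_minus_one_minus delta_def)
    next
      case 5
      show ?thesis
        unfolding 5 Heq q
        by (rule series_solution_rescale[OF series_solution_minus[OF h(1,2), of "-1" 0],
            where \<sigma> = "\<lambda>l. 1" and K = 1]) (auto simp: nf power_int_minus_one_minus delta_def)
    next
      case 6
      show ?thesis
        unfolding 6 Heq q
        by (rule series_solution_rescale[OF series_solution_minus[OF h(1,2), of "-1" 1],
            where \<sigma> = "\<lambda>l. 1" and G = "\<lambda>l. minus_term (-1) 1 (inverse h) (- l)"
              and K = "qpow (- \<tau>) (- 1 / 8) / (1 + qpow (- \<tau>) (- 1 / 2))\<^sup>2"])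
          (auto simp: nf delta_def)
    qed
  qed
qed

theorem theorem2:
  fixes q \<tau> :: complex and j :: nat and l :: int
  assumes "j \<in> {0..5}"
    and "q = exp (2 * complex_of_real pi * \<i> * \<tau>)"
    and "0 < norm q" and "norm q \<noteq> 1"
  shows "H j (l + 6) \<tau> + 2 * H j (l + 5) \<tau> - (q + q powi (l + 4)) * H j (l + 4) \<tau>
    - 2 * (q + 1) * H j (l + 3) \<tau> - H j (l + 2) \<tau> + 2 * q * H j (l + 1) \<tau> + q * H j l \<tau> = 0"
proof -
  have q: "q = nome \<tau>" using assms(2) by (simp add: qpow_def)
  have "solves_at q (\<lambda>l. H j l \<tau>) l"
    unfolding q using assms(1,4) by (intro H_solution) (auto simp: q)
  thus ?thesis unfolding solves_at_def const_op_def by algebra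
qed

end
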